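(* Let $n\geq 3$. The number of arithmetical structures on the bident $D_n$ is \[ \lvert\operatorname{Arith}(D_n)\rvert=2C(n-2)+\sum_{m=4}^{n}B(n-3,n-m)\,\lvert\operatorname{SArith}(D_m)\rvert, \] where $C(j)=\frac{1}{j+1}\binom{2j}{j}$ is the $j$-th Catalan number and $B(j,k)=\frac{j-k+1}{j+1}\binom{j+k}{j}$ (for $j\ge k\ge 0$) is a ballot number.
   Context: For $n\ge 3$ let $\ell=n-3$. The bident $D_n$ is the graph with vertices $v_x,v_y,v_0,v_1,\dots,v_\ell$ and edges $v_xv_0$, $v_yv_0$, and $v_{i}v_{i+1}$ for $0\le i\le \ell-1$ (so $D_3$ is the path $v_x v_0 v_y$). For a finite connected graph $G$ with $n$ vertices and adjacency matrix $A$, an arithmetical structure on $G$ is a pair $(\mathbf d,\mathbf r)$ of vectors with positive integer entries indexed by the vertices such that $(\operatorname{diag}(\mathbf d)-A)\mathbf r=\mathbf 0$ and the entries of $\mathbf r$ have no nontrivial common factor. On $D_n$ we write $\mathbf d=(d_x,d_y,d_0,\dots,d_\ell)$, $\mathbf r=(r_x,r_y,r_0,\dots,r_\ell)$. $\operatorname{Arith}(D_n)$ is the set of arithmetical structures on $D_n$. An arithmetical structure on $D_n$ is smooth if $d_x,d_y,d_1,\dots,d_\ell\ge 2$ (no condition on $d_0$); $\operatorname{SArith}(D_m)$ denotes the set of smooth arithmetical structures on $D_m$. *)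

theory Defs
  imports Complex_Main "HOL-Library.FuncSet"
begin

definition adjacency :: "'v set set \<Rightarrow> 'v \<Rightarrow> 'v \<Rightarrow> int" where
  "adjacency E u v = (if {u, v} \<in> E then 1 else 0)"

definition diag_matrix :: "('v \<Rightarrow> int) \<Rightarrow> 'v \<Rightarrow> 'v \<Rightarrow> int" where
  "diag_matrix d u v = (if u = v then d u else 0)"

text \<open>Vectors indexed by the vertex set \<open>V\<close> are extensional functions on \<open>V\<close>, so that
  each structure is represented exactly once.\<close>

definition Arith :: "'v set \<Rightarrow> 'v set set \<Rightarrow> (('v \<Rightarrow> int) \<times> ('v \<Rightarrow> int)) set" where
  "Arith V E = {(d, r).
     d \<in> V \<rightarrow>\<^sub>E {0<..} \<and> r \<in> V \<rightarrow>\<^sub>E {0<..} \<and>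
     (\<forall>u\<in>V. (\<Sum>v\<in>V. (diag_matrix d u v - adjacency E u v) * r v) = 0) \<and>
     Gcd (r ` V) = 1}"

datatype bident_vertex = VX | VY | V nat

definition bident_verts :: "nat \<Rightarrow> bident_vertex set" where
  "bident_verts n = {VX, VY} \<union> V ` {0..n - 3}"

definition bident_edges :: "nat \<Rightarrow> bident_vertex set set" where
  "bident_edges n = {{VX, V 0}, {VY, V 0}} \<union> {{V i, V (Suc i)} | i. i < n - 3}"

definition Arith_bident ::
    "nat \<Rightarrow> ((bident_vertex \<Rightarrow> int) \<times> (bident_vertex \<Rightarrow> int)) set" where
  "Arith_bident n = Arith (bident_verts n) (bident_edges n)"

definition SArith_bident ::
    "nat \<Rightarrow> ((bident_vertex \<Rightarrow> int) \<times> (bident_vertex \<Rightarrow> int)) set" where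
  "SArith_bident n = {(d, r) \<in> Arith_bident n.
     d VX \<ge> 2 \<and> d VY \<ge> 2 \<and> (\<forall>i\<in>{1..n - 3}. d (V i) \<ge> 2)}"

definition catalan :: "nat \<Rightarrow> real" where
  "catalan j = 1 / (real j + 1) * real ((2 * j) choose j)"

definition ballot :: "nat \<Rightarrow> nat \<Rightarrow> real" where
  "ballot j k = (real j - real k + 1) / (real j + 1) * real ((j + k) choose j)"

end

theory Submission
  imports Defs
begin

text \<open>A structure is determined by \<open>r\<close>. If \<open>r\<^sub>i = r\<^sub>i\<^sub>-\<^sub>1 + r\<^sub>i\<^sub>+\<^sub>1\<close> for some \<open>i \<ge> 1\<close> (that is, \<open>d\<^sub>i = 1\<close>), the
  vertex \<open>v\<^sub>i\<close> can be contracted, and conversely a vertex can be inserted at any position of the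
  tail. Always contracting the last possible vertex yields a generating tree: the structures on a
  tail of length \<open>l + 1\<close> whose last contractible position is exactly \<open>p\<close> correspond to the
  structures on a tail of length \<open>l\<close> with no contractible position beyond \<open>p\<close>. Solving this
  recurrence by the reflection principle gives ballot numbers times the numbers of structures
  with no contractible position. Structures with \<open>d\<^sub>x = 1\<close> or \<open>d\<^sub>y = 1\<close> are structures on paths,
  counted by the same recurrence, which yields the Catalan numbers. The sets involved are finite
  because the diagonals \<open>d\<close> form an antichain, to which Dickson's lemma applies.\<close>

section \<open>Contracting the tail\<close>

text \<open>The tail \<open>r\<^sub>0, \<dots>, r\<^sub>l\<close> is extended by zeros, so that the last vertex needs no separate
  treatment.\<close>

definition tails :: "nat \<Rightarrow> (nat \<Rightarrow> int) set" where
  "tails l = {r. (\<forall>i\<le>l. 0 < r i) \<and> (\<forall>i>l. r i = 0) \<and>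
     (\<forall>i<l. r (Suc i) dvd r i + r (Suc (Suc i)))}"

text \<open>Position \<open>i + 1\<close> is contractible if \<open>r (i + 1) = r i + r (i + 2)\<close>; the parameter \<open>p\<close> bounds
  the contractible positions. \<open>Q\<close> expresses the conditions at the root \<open>v\<^sub>0\<close>, where \<open>h\<close> holds the labels
  outside the tail.\<close>

definition rooted :: "('h \<Rightarrow> int \<Rightarrow> int \<Rightarrow> bool) \<Rightarrow> nat \<Rightarrow> nat \<Rightarrow> ('h \<times> (nat \<Rightarrow> int)) set" where
  "rooted Q l p = {(h, r). r \<in> tails l \<and> Q h (r 0) (r 1) \<and>
     (\<forall>i. p \<le> i \<and> i < l \<longrightarrow> r (Suc i) \<noteq> r i + r (Suc (Suc i)))}"

definition contract :: "nat \<Rightarrow> (nat \<Rightarrow> int) \<Rightarrow> nat \<Rightarrow> int" where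
  "contract p r = (\<lambda>j. if j \<le> p then r j else r (Suc j))"

text \<open>The inserted label is the sum of its neighbours, so the new vertex has diagonal entry 1.
  On a tail of length \<open>p\<close> the zero padding makes this append a copy of the last
  label.\<close>

definition subdivide :: "nat \<Rightarrow> (nat \<Rightarrow> int) \<Rightarrow> nat \<Rightarrow> int" where
  "subdivide p r = (\<lambda>j. if j \<le> p then r j else if j = Suc p then r p + r (Suc p) else r (j - 1))"

lemma contract_subdivide: "contract p (subdivide p r) = r"
  by (auto simp: contract_def subdivide_def fun_eq_iff)

lemma subdivide_contract:
  "r (Suc p) = r p + r (Suc (Suc p)) \<Longrightarrow> subdivide p (contract p r) = r"
  by (auto simp: contract_def subdivide_def fun_eq_iff)

text \<open>Removing a label equal to the sum of its neighbours lowers the neighbour sum at either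
  adjacent position by that position's own label, and leaves the other conditions untouched.
  Subdividing raises these sums in the same way.\<close>

lemma contract_tails:
  assumes r: "r \<in> tails (Suc l)" and p: "p \<le> l"
    and flat: "r (Suc p) = r p + r (Suc (Suc p))"
  shows "contract p r \<in> tails l"
proof -
  have dv: "r (Suc i) dvd r i + r (Suc (Suc i))" if "i < Suc l" for i
    using r that by (auto simp: tails_def)
  have "contract p r (Suc i) dvd contract p r i + contract p r (Suc (Suc i))" if i: "i < l" for i
  proof -
    consider "Suc i < p" | "Suc i = p" | "i = p" | "p < i" by linarith
    then show ?thesis
    proof cases
      case 2
      have "r p dvd r i + r (Suc p)" using dv[of i] i 2 by auto
      moreover have "r i + r (Suc p) = (r i + r (Suc (Suc p))) + r p" using flat by simp
      ultimately have "r p dvd r i + r (Suc (Suc p))" by (metis dvd_add_triv_right_iff)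
      then show ?thesis using 2 by (auto simp: contract_def)
    next
      case 3
      have "r (Suc (Suc p)) dvd r (Suc p) + r (Suc (Suc (Suc p)))" using dv[of "Suc p"] i 3 by auto
      moreover have "r (Suc p) + r (Suc (Suc (Suc p)))
          = (r p + r (Suc (Suc (Suc p)))) + r (Suc (Suc p))" using flat by simp
      ultimately have "r (Suc (Suc p)) dvd r p + r (Suc (Suc (Suc p)))"
        by (metis dvd_add_triv_right_iff)
      then show ?thesis using 3 by (auto simp: contract_def)
    qed (use dv[of i] dv[of "Suc i"] i in \<open>auto simp: contract_def\<close>)
  qed
  then show ?thesis using r p by (auto simp: tails_def contract_def)
qed

lemma subdivide_tails:
  assumes r: "r \<in> tails l" and p: "p \<le> l"
  shows "subdivide p r \<in> tails (Suc l)"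
proof -
  have dv: "r (Suc i) dvd r i + r (Suc (Suc i))" if "i < l" for i
    using r that by (auto simp: tails_def)
  have nn: "0 \<le> r i" for i
    using r by (cases "i \<le> l") (auto simp: tails_def less_imp_le)
  have pos: "0 < r i" if "i \<le> l" for i using r that by (auto simp: tails_def)
  have zero: "r i = 0" if "l < i" for i using r that by (auto simp: tails_def)
  have "subdivide p r (Suc i) dvd subdivide p r i + subdivide p r (Suc (Suc i))"
    if i: "i < Suc l" for i
  proof -
    consider "Suc i < p" | "Suc i = p" | "i = p" | "i = Suc p" | "Suc p < i" by linarith
    then show ?thesis
    proof cases
      case 2
      have "r p dvd (r i + r (Suc p)) + r p" using dv[of i] p 2 by auto
      then show ?thesis using 2 by (auto simp: subdivide_def algebra_simps)
    next
      case 4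
      have "r (Suc p) dvd (r p + r (Suc (Suc p))) + r (Suc p)" using dv[of p] i 4 by auto
      then show ?thesis using 4 by (auto simp: subdivide_def algebra_simps)
    next
      case 5
      then obtain j where "i = Suc j" by (cases i) auto
      then show ?thesis using 5 dv[of j] i by (auto simp: subdivide_def)
    qed (use dv[of i] i p in \<open>auto simp: subdivide_def\<close>)
  qed
  moreover have "0 < subdivide p r i" if "i \<le> Suc l" for i
    using pos[of i] pos[of p] pos[of "i - 1"] nn[of "Suc p"] that p
    by (auto simp: subdivide_def)
  moreover have "subdivide p r i = 0" if "Suc l < i" for i
    using zero[of "i - 1"] that p by (auto simp: subdivide_def)
  ultimately show ?thesis by (auto simp: tails_def)
qed

text \<open>Position \<open>p + 1\<close> is the last one still allowed to be contractible; if it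
  is, \<open>contract p\<close> removes it. The former position \<open>p + 2\<close> moves there and
  may become contractible, so the bound stays \<open>Suc p\<close>.\<close>

lemma rooted_split:
  assumes Q: "\<And>h a b. Q h a (a + b) = Q h a b" and p: "p \<le> l"
    and fin: "finite (rooted Q (Suc l) (Suc p))"
  shows "card (rooted Q (Suc l) (Suc p)) = card (rooted Q (Suc l) p) + card (rooted Q l (Suc p))"
proof -
  let ?F = "{(h, r) \<in> rooted Q (Suc l) (Suc p). r (Suc p) = r p + r (Suc (Suc p))}"
  have un: "rooted Q (Suc l) (Suc p) = rooted Q (Suc l) p \<union> ?F"
    using p by (auto simp: rooted_def) (metis Suc_leI le_neq_implies_less)
  have disj: "rooted Q (Suc l) p \<inter> ?F = {}"
    using p by (auto simp: rooted_def)
  \<comment> \<open>Contraction affects a root argument only for \<open>p = 0\<close>, where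
    \<open>r 1 = r 0 + r 2\<close> becomes \<open>r 2\<close>; \<open>Q\<close> does not distinguish
    the two.\<close>
  have head: "Q h (contract p r 0) (contract p r 1) = Q h (r 0) (r 1)"
    if "r (Suc p) = r p + r (Suc (Suc p))" for h r
    using that Q[of h "r 0" "r 2"] by (cases p) (auto simp: contract_def numeral_2_eq_2)
  have "bij_betw (map_prod id (contract p)) ?F (rooted Q l (Suc p))"
  proof (rule bij_betw_byWitness[where f' = "map_prod id (subdivide p)"])
    show "\<forall>a\<in>?F. map_prod id (subdivide p) (map_prod id (contract p) a) = a"
      by (auto simp: subdivide_contract)
    show "\<forall>a\<in>rooted Q l (Suc p). map_prod id (contract p) (map_prod id (subdivide p) a) = a"
      by (auto simp: contract_subdivide)
    show "map_prod id (contract p) ` ?F \<subseteq> rooted Q l (Suc p)"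
    proof clarsimp
      fix h r assume r: "(h, r) \<in> rooted Q (Suc l) (Suc p)"
        and flat: "r (Suc p) = r p + r (Suc (Suc p))"
      have nf: "r (Suc i) \<noteq> r i + r (Suc (Suc i))" if "Suc p \<le> i" "i < Suc l" for i
        using r that by (auto simp: rooted_def)
      have "contract p r (Suc i) \<noteq> contract p r i + contract p r (Suc (Suc i))"
        if "Suc p \<le> i" "i < l" for i
        using that nf[of "Suc i"] by (auto simp: contract_def)
      then show "(h, contract p r) \<in> rooted Q l (Suc p)"
        using r contract_tails[OF _ p flat] head[OF flat] by (auto simp: rooted_def)
    qed
    show "map_prod id (subdivide p) ` rooted Q l (Suc p) \<subseteq> ?F"
    proof clarsimp
      fix h r assume r: "(h, r) \<in> rooted Q l (Suc p)"
      have nf: "r (Suc i) \<noteq> r i + r (Suc (Suc i))" if "Suc p \<le> i" "i < l" for i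
        using r that by (auto simp: rooted_def)
      have t: "r \<in> tails l" using r by (auto simp: rooted_def)
      have nn: "0 \<le> r i" for i
        using t by (cases "i \<le> l") (auto simp: tails_def less_imp_le)
      have pos: "0 < r p" using t p by (auto simp: tails_def)
      have flat: "subdivide p r (Suc p) = subdivide p r p + subdivide p r (Suc (Suc p))"
        by (auto simp: subdivide_def)
      have "subdivide p r (Suc i) \<noteq> subdivide p r i + subdivide p r (Suc (Suc i))"
        if i: "Suc p \<le> i" "i < Suc l" for i
      \<comment> \<open>The neighbour sum of the label after the inserted one exceeds it by
        \<open>r p + r (Suc (Suc p))\<close>, which is positive.\<close>
      proof (cases "i = Suc p")
        case True
        then show ?thesis using pos nn[of "Suc (Suc p)"] by (auto simp: subdivide_def)
      next
        case False
        then obtain j where "i = Suc j" "Suc p \<le> j" using i by (cases i) auto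
        then show ?thesis using nf[of j] i by (auto simp: subdivide_def)
      qed
      then show "(h, subdivide p r) \<in> rooted Q (Suc l) (Suc p) \<and>
          subdivide p r (Suc p) = subdivide p r p + subdivide p r (Suc (Suc p))"
        using r subdivide_tails[OF t p] flat head[OF flat, of h]
        by (auto simp: rooted_def contract_subdivide)
    qed
  qed
  then have "card ?F = card (rooted Q l (Suc p))" by (rule bij_betw_same_card)
  then show ?thesis
    using card_Un_disjoint[OF _ _ disj] fin un by (metis (no_types, lifting) finite_Un)
qed

section \<open>Ballot numbers\<close>

text \<open>The number of weakly increasing sequences \<open>1 \<le> i\<^sub>1 \<le> \<dots> \<le> i\<^sub>k \<le> p\<close> with
  \<open>i\<^sub>j \<le> l - k + j\<close>, by the reflection principle, for \<open>p \<le> l + 1\<close>; truncated subtraction makes it correct for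
  \<open>p = 0\<close> as well.\<close>

definition path_diff :: "nat \<Rightarrow> nat \<Rightarrow> nat \<Rightarrow> real" where
  "path_diff p k l = real ((p + k - 1) choose k) - real ((p + k - 1) choose (l + 1))"

lemma path_diff_Suc:
  "path_diff (Suc p) (Suc k) (Suc l) = path_diff p (Suc k) (Suc l) + path_diff (Suc p) k l"
  by (simp add: path_diff_def)

text \<open>For \<open>k > 0\<close> Pascal's rule leaves the difference
  \<open>(l + k - 1 choose (k - 1)) - (l + k - 1 choose l)\<close>, zero by symmetry. It mirrors
  that the bounds \<open>l\<close> and \<open>l + 1\<close> admit the same tails.\<close>

lemma path_diff_boundary:
  assumes "k \<le> l"
  shows "path_diff (Suc l) k l = path_diff l k l"
proof (cases k)
  case 0
  then show ?thesis by (simp add: path_diff_def binomial_eq_0)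
next
  case (Suc j)
  have "(l + j) choose j = (l + j) choose l"
    using binomial_symmetric[of j "l + j"] by simp
  then show ?thesis using Suc by (simp add: path_diff_def)
qed

lemma path_diff_ballot: "path_diff (Suc l) k l = ballot l k"
proof -
  have "real (Suc l) * real ((l + k) choose Suc l) = real k * real ((l + k) choose l)"
    using binomial_absorb_comp[of "l + k" l] binomial_absorption[of l "l + k"]
    by (metis add_diff_cancel_left' of_nat_mult)
  moreover have "(l + k) choose k = (l + k) choose l"
    using binomial_symmetric[of k "l + k"] by simp
  ultimately show ?thesis by (simp add: path_diff_def ballot_def field_simps)
qed

text \<open>By linearity \<open>f l p\<close> is a combination of the values \<open>f s 0\<close>;
  the coefficients \<open>path_diff p (l - s) l\<close> obey the same recurrence and boundary
  condition.\<close>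

lemma ballot_recurrence:
  fixes f :: "nat \<Rightarrow> nat \<Rightarrow> nat"
  assumes step: "\<And>l p. p \<le> l \<Longrightarrow> f (Suc l) (Suc p) = f (Suc l) p + f l (Suc p)"
    and top: "\<And>l. f l (Suc l) = f l l"
  shows "real (f l l) = (\<Sum>s\<le>l. ballot l (l - s) * real (f s 0))"
proof -
  have "real (f l p) = (\<Sum>s\<le>l. path_diff p (l - s) l * real (f s 0))" if "p \<le> Suc l" for p
    using that
  proof (induction l arbitrary: p)
    case 0
    then have "p = 0 \<or> p = 1" by auto
    then show ?case using top[of 0] by (auto simp: path_diff_def)
  next
    case (Suc l)
    have *: "real (f (Suc l) p) = (\<Sum>s\<le>Suc l. path_diff p (Suc l - s) (Suc l) * real (f s 0))"
      if "p \<le> Suc l" for p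
      using that
    proof (induction p)
      case 0
      have "path_diff 0 (Suc l - s) (Suc l) = 0" if "s \<le> l" for s
        using that by (simp add: path_diff_def Suc_diff_le binomial_eq_0)
      moreover have "path_diff 0 0 (Suc l) = 1" by (simp add: path_diff_def)
      ultimately show ?case by simp
    next
      case (Suc p)
      have *: "path_diff (Suc p) (Suc l - s) (Suc l) * real (f s 0)
          = path_diff p (Suc l - s) (Suc l) * real (f s 0) + path_diff (Suc p) (l - s) l * real (f s 0)"
        if "s \<le> l" for s
        using that path_diff_Suc[of p "l - s" l] by (simp add: Suc_diff_le algebra_simps)
      \<comment> \<open>The summand \<open>s = l + 1\<close> has no counterpart in row
        \<open>l\<close>, so its coefficient must agree at \<open>p\<close> and
        \<open>p + 1\<close>.\<close>
      have one: "path_diff (Suc p) 0 (Suc l) = path_diff p 0 (Suc l)"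
        using Suc.prems by (simp add: path_diff_def binomial_eq_0)
      have "real (f (Suc l) (Suc p)) = real (f (Suc l) p) + real (f l (Suc p))"
        using step[of p l] Suc.prems by simp
      also have "\<dots> = (\<Sum>s\<le>Suc l. path_diff p (Suc l - s) (Suc l) * real (f s 0))
          + (\<Sum>s\<le>l. path_diff (Suc p) (l - s) l * real (f s 0))"
        using Suc.IH Suc.prems \<open>\<And>p. p \<le> Suc l \<Longrightarrow> real (f l p) = _\<close>[of "Suc p"] by simp
      also have "\<dots> = (\<Sum>s\<le>Suc l. path_diff (Suc p) (Suc l - s) (Suc l) * real (f s 0))"
        using one by (simp add: * sum.distrib)
      finally show ?case .
    qed
    show ?case
    proof (cases "p = Suc (Suc l)")
      case True
      have "real (f (Suc l) p) = (\<Sum>s\<le>Suc l. path_diff (Suc l) (Suc l - s) (Suc l) * real (f s 0))"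
        using *[OF order_refl] by (simp only: True top)
      also have "\<dots> = (\<Sum>s\<le>Suc l. path_diff p (Suc l - s) (Suc l) * real (f s 0))"
        by (intro sum.cong refl) (simp only: True path_diff_boundary diff_le_self)
      finally show ?thesis .
    next
      case False
      show ?thesis by (rule *) (use False Suc.prems in simp)
    qed
  qed
  from this[of "Suc l"] show ?thesis by (simp add: top path_diff_ballot)
qed

text \<open>On a tail of length \<open>l\<close> the bound \<open>l\<close> excludes no position and
  the bound 0 excludes all, so this counts all structures through those with nothing left to
  contract.\<close>

lemma card_rooted:
  assumes Q: "\<And>h a b. Q h a (a + b) = Q h a b"
    and fin: "\<And>l p. finite (rooted Q l p)"
  shows "real (card (rooted Q l l)) = (\<Sum>s\<le>l. ballot l (l - s) * real (card (rooted Q s 0)))"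
proof (rule ballot_recurrence)
  show "card (rooted Q (Suc l) (Suc p)) = card (rooted Q (Suc l) p) + card (rooted Q l (Suc p))"
    if "p \<le> l" for l p
    using rooted_split[of Q, OF Q that fin] .
  show "card (rooted Q l (Suc l)) = card (rooted Q l l)" for l
    by (rule arg_cong[where f = card]) (auto simp: rooted_def)
qed

section \<open>Smooth tails and structures on paths\<close>

text \<open>Every quotient is at least 2, so
  \<open>r i \<ge> 2 * r (Suc i) - r (Suc (Suc i))\<close>; strict decrease spreads backwards from
  the end, where it reads \<open>0 < r l\<close>.\<close>

lemma smooth_tail_decreasing:
  assumes r: "r \<in> tails l" and nf: "\<And>i. i < l \<Longrightarrow> r (Suc i) \<noteq> r i + r (Suc (Suc i))"
    and "i \<le> l"
  shows "r (Suc i) < r i"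
  using \<open>i \<le> l\<close>
proof (induction i rule: inc_induct)
  case base
  then show ?case using r by (auto simp: tails_def)
next
  case (step i)
  have "r (Suc i) dvd r i + r (Suc (Suc i))" using r step by (auto simp: tails_def)
  then obtain k where k: "r i + r (Suc (Suc i)) = r (Suc i) * k" ..
  have pos: "0 < r i" "0 < r (Suc i)" using r step by (auto simp: tails_def)
  have "0 \<le> r (Suc (Suc i))"
    using r by (cases "Suc (Suc i) \<le> l") (auto simp: tails_def less_imp_le)
  have "0 < r (Suc i) * k" using k pos \<open>0 \<le> r (Suc (Suc i))\<close> by linarith
  then have "0 < k" using pos by (simp add: zero_less_mult_iff)
  moreover have "k \<noteq> 1" using k nf[of i] step by auto
  ultimately have "2 \<le> k" by linarith
  then have "r (Suc i) * 2 \<le> r (Suc i) * k" using pos by (intro mult_left_mono) auto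
  then show ?case using k step by linarith
qed

text \<open>A structure on a path has end label 1, and this is the only condition at the root.\<close>

definition path_root :: "unit \<Rightarrow> int \<Rightarrow> int \<Rightarrow> bool" where
  "path_root h a b \<longleftrightarrow> a = 1"

text \<open>A strictly decreasing tail that starts at 1 has no room for a second positive label, so
  only \<open>s = 0\<close> contributes, with coefficient \<open>ballot l l\<close>.\<close>

lemma card_path_root:
  assumes fin: "\<And>l p. finite (rooted path_root l p)"
  shows "real (card (rooted path_root l l)) = catalan l"
proof -
  have "rooted path_root s 0 = {}" if "0 < s" for s
  proof -
    have "False" if "(h, r) \<in> rooted path_root s 0" for h r
    proof -
      have t: "r \<in> tails s" and "r 0 = 1" and "\<And>i. i < s \<Longrightarrow> r (Suc i) \<noteq> r i + r (Suc (Suc i))"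
        using that by (auto simp: rooted_def path_root_def)
      then have "r 1 < 1" using smooth_tail_decreasing[OF t, of 0] by simp
      moreover have "0 < r 1" using t \<open>0 < s\<close> by (auto simp: tails_def)
      ultimately show False by linarith
    qed
    then show ?thesis by auto
  qed
  then have zero: "card (rooted path_root s 0) = 0" if "0 < s" for s using that by simp
  have "rooted path_root 0 0 = {((), \<lambda>i. if i = 0 then 1 else 0)}"
    by (auto simp: rooted_def path_root_def tails_def fun_eq_iff)
  then have one: "card (rooted path_root 0 0) = 1" by simp
  have "real (card (rooted path_root l l))
      = (\<Sum>s\<le>l. ballot l (l - s) * real (card (rooted path_root s 0)))"
    by (rule card_rooted) (auto simp: path_root_def fin)
  also have "\<dots> = (\<Sum>s\<in>{0}. ballot l (l - s) * real (card (rooted path_root s 0)))"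
    by (rule sum.mono_neutral_right) (auto simp: zero)
  also have "\<dots> = catalan l" by (simp add: one ballot_def catalan_def mult_2)
  finally show ?thesis .
qed

section \<open>Finiteness\<close>

lemma nat_seq_incseq_subseq:
  fixes s :: "nat \<Rightarrow> nat"
  shows "\<exists>g. strict_mono g \<and> incseq (\<lambda>n. s (g n))"
proof -
  \<comment> \<open>\<open>g\<close> starts where \<open>s\<close> is minimal and always moves on to
    a minimum among the later positions; minima over shrinking sets cannot decrease.\<close>
  define g where "g = rec_nat (ARG_MIN s m. True) (\<lambda>_ k. ARG_MIN s m. k < m)"
  have g0: "s (g 0) \<le> s m" for m
    unfolding g_def by (simp add: arg_min_nat_le)
  have gS: "g n < g (Suc n)" and gmin: "g n < m \<Longrightarrow> s (g (Suc n)) \<le> s m" for n m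
    using arg_min_natI[of "\<lambda>m. g n < m" "Suc (g n)" s] arg_min_nat_le[of "\<lambda>m. g n < m" m s]
    by (auto simp: g_def)
  have sm: "strict_mono g" using gS by (simp add: strict_mono_Suc_iff)
  have "s (g n) \<le> s (g (Suc n))" for n
  proof (cases n)
    case (Suc k)
    then show ?thesis using gmin[of k "g (Suc n)"] gS[of k] gS[of n] by simp
  qed (simp add: g0)
  then have "incseq (\<lambda>n. s (g n))" by (simp add: incseq_Suc_iff)
  with sm show ?thesis by blast
qed

text \<open>One coordinate is treated at a time: passing to a further subsequence keeps the earlier
  coordinates monotone.\<close>

lemma dickson_subseq:
  fixes f :: "nat \<Rightarrow> 'v \<Rightarrow> nat"
  assumes "finite A"
  shows "\<exists>g. strict_mono g \<and> (\<forall>v\<in>A. incseq (\<lambda>n. f (g n) v))"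
  using assms
proof (induction A rule: finite_induct)
  case empty
  show ?case by (rule exI[of _ id]) (simp add: strict_mono_def)
next
  case (insert a A)
  then obtain g where g: "strict_mono g" "\<forall>v\<in>A. incseq (\<lambda>n. f (g n) v)" by blast
  obtain h where h: "strict_mono h" "incseq (\<lambda>n. f (g (h n)) a)"
    using nat_seq_incseq_subseq[of "\<lambda>n. f (g n) a"] by blast
  have "strict_mono (g \<circ> h)" using g(1) h(1) by (rule strict_mono_o)
  moreover have "incseq (\<lambda>n. f ((g \<circ> h) n) v)" if "v \<in> insert a A" for v
    using that h(2) g(2) strict_mono_mono[OF h(1)] by (auto simp: incseq_def mono_def)
  ultimately show ?case by blast
qed

text \<open>Pairing the equations of two structures through the symmetric adjacency matrix gives
  \<open>\<Sum> (d' v - d v) * r v * r' v = 0\<close>, so comparable diagonals coincide.\<close>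

lemma Arith_diagonal_antichain:
  assumes fin: "finite S" and 1: "(d, r) \<in> Arith S E" and 2: "(d', r') \<in> Arith S E"
    and le: "\<And>v. v \<in> S \<Longrightarrow> d v \<le> d' v"
  shows "d = d'"
proof -
  have e: "(\<Sum>v\<in>S. (diag_matrix d u v - adjacency E u v) * r v) = 0"
    and e': "(\<Sum>v\<in>S. (diag_matrix d' u v - adjacency E u v) * r' v) = 0" if "u \<in> S" for u
    using 1 2 that by (auto simp: Arith_def)
  have pos: "0 < r v" "0 < r' v" if "v \<in> S" for v
    using 1 2 that by (auto simp: Arith_def PiE_iff)
  have diag: "(\<Sum>v\<in>S. diag_matrix c u v * s v) = c u * s u" if "u \<in> S" for c s and u
    using fin that by (simp add: diag_matrix_def if_distrib[of "\<lambda>x. x * _"] sum.delta cong: if_cong)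
  have m: "d u * r u = (\<Sum>v\<in>S. adjacency E u v * r v)"
    and m': "d' u * r' u = (\<Sum>v\<in>S. adjacency E u v * r' v)" if "u \<in> S" for u
    using e[OF that] e'[OF that] diag[OF that]
    by (simp_all add: left_diff_distrib sum_subtractf)
  have sym: "adjacency E u v = adjacency E v u" for u v
    by (simp add: adjacency_def insert_commute)
  have "(\<Sum>u\<in>S. d u * r u * r' u) = (\<Sum>u\<in>S. \<Sum>v\<in>S. adjacency E u v * r v * r' u)"
    by (intro sum.cong refl) (simp add: m sum_distrib_right)
  also have "\<dots> = (\<Sum>v\<in>S. \<Sum>u\<in>S. adjacency E u v * r v * r' u)" by (rule sum.swap)
  also have "\<dots> = (\<Sum>v\<in>S. d' v * r' v * r v)"
    by (intro sum.cong refl) (simp add: m' sum_distrib_left sym mult_ac)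
  finally have "(\<Sum>v\<in>S. (d' v - d v) * (r v * r' v)) = 0"
    by (simp add: algebra_simps sum_subtractf)
  moreover have "0 \<le> (d' v - d v) * (r v * r' v)" if "v \<in> S" for v
    using le[OF that] pos[OF that] by simp
  ultimately have z: "(d' v - d v) * (r v * r' v) = 0" if "v \<in> S" for v
    using sum_nonneg_eq_0_iff[OF fin, of "\<lambda>v. (d' v - d v) * (r v * r' v)"] that by auto
  have "d v = d' v" if "v \<in> S" for v using z[OF that] pos[OF that] by auto
  then show ?thesis using 1 2 by (intro PiE_ext[of d S _ d']) (auto simp: Arith_def)
qed

text \<open>Infinitely many diagonals would give an injective sequence, and Dickson's lemma two
  comparable members of it, against the antichain property.\<close>

lemma finite_Arith_diagonals:
  assumes fin: "finite S"
  shows "finite (fst ` Arith S E)"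
proof (rule ccontr)
  assume "infinite (fst ` Arith S E)"
  then obtain s :: "nat \<Rightarrow> 'a \<Rightarrow> int" where s: "inj s" "range s \<subseteq> fst ` Arith S E"
    using infinite_countable_subset by blast
  obtain g where g: "strict_mono g" "\<forall>v\<in>S. incseq (\<lambda>n. nat (s (g n) v))"
    using dickson_subseq[OF fin, of "\<lambda>n v. nat (s n v)"] by blast
  obtain r where r: "(s (g 0), r) \<in> Arith S E" using s(2) by force
  obtain r' where r': "(s (g 1), r') \<in> Arith S E" using s(2) by force
  have "s (g 0) v \<le> s (g 1) v" if "v \<in> S" for v
  proof -
    have "nat (s (g 0) v) \<le> nat (s (g 1) v)"
      using g(2) that by (auto simp: incseq_def)
    moreover have "0 < s (g 1) v" using r' that by (auto simp: Arith_def PiE_iff)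
    ultimately show ?thesis by linarith
  qed
  then have "s (g 0) = s (g 1)" using Arith_diagonal_antichain[OF fin r r'] by blast
  then have "g 0 = g 1" using s(1) by (simp add: inj_eq)
  then show False using g(1) by (metis strict_mono_eq zero_neq_one)
qed

section \<open>Vertex equations on the bident\<close>

definition tail_of :: "nat \<Rightarrow> (bident_vertex \<Rightarrow> int) \<Rightarrow> nat \<Rightarrow> int" where
  "tail_of l r i = (if i \<le> l then r (V i) else 0)"

lemma bident_verts_cases:
  "v \<in> bident_verts (l + 3) \<longleftrightarrow> v = VX \<or> v = VY \<or> v = V 0 \<or> (\<exists>i<l. v = V (Suc i))"
proof -
  have "{0..l} = insert 0 (Suc ` {..<l})"
    by (metis atLeast0AtMost lessThan_Suc_atMost lessThan_Suc_eq_insert_0)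
  then show ?thesis by (auto simp: bident_verts_def)
qed

text \<open>Row \<open>u\<close> of the matrix equation says that \<open>d u * r u\<close> is the
  sum over the neighbours of \<open>u\<close>. The zero padding stands in for the missing successor
  of \<open>V l\<close>, also when \<open>l = 0\<close>.\<close>

lemma Arith_bident_iff:
  "(d, r) \<in> Arith_bident (l + 3) \<longleftrightarrow>
    d \<in> bident_verts (l + 3) \<rightarrow>\<^sub>E {0<..} \<and> r \<in> bident_verts (l + 3) \<rightarrow>\<^sub>E {0<..} \<and>
    d VX * r VX = r (V 0) \<and> d VY * r VY = r (V 0) \<and>
    d (V 0) * r (V 0) = r VX + r VY + tail_of l r 1 \<and>
    (\<forall>i<l. d (V (Suc i)) * tail_of l r (Suc i) = tail_of l r i + tail_of l r (Suc (Suc i))) \<and>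
    Gcd (r ` bident_verts (l + 3)) = 1"
proof -
  let ?V = "bident_verts (l + 3)" and ?E = "bident_edges (l + 3)"
  have V: "?V = insert VX (insert VY (V ` {0..l}))" by (auto simp: bident_verts_def)
  have fin: "finite ?V" by (simp add: V)
  have nbr: "(\<Sum>v\<in>?V. (diag_matrix d u v - adjacency ?E u v) * r v)
      = d u * r u - (\<Sum>v\<in>{v\<in>?V. {u, v} \<in> ?E}. r v)" if "u \<in> ?V" for u
  proof -
    have "(\<Sum>v\<in>?V. (diag_matrix d u v - adjacency ?E u v) * r v)
        = (\<Sum>v\<in>?V. if u = v then d u * r v else 0) - (\<Sum>v\<in>?V. if {u, v} \<in> ?E then r v else 0)"
      unfolding sum_subtractf[symmetric]
      by (intro sum.cong refl) (auto simp: diag_matrix_def adjacency_def algebra_simps)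
    then show ?thesis using fin that by (simp add: sum.inter_filter)
  qed
  have nbrs: "{v\<in>?V. {VX, v} \<in> ?E} = {V 0}" "{v\<in>?V. {VY, v} \<in> ?E} = {V 0}"
      "{v\<in>?V. {V 0, v} \<in> ?E} = (if 0 < l then {VX, VY, V 1} else {VX, VY})"
    by (auto simp: V bident_edges_def doubleton_eq_iff)
  have nbrS: "{v\<in>?V. {V (Suc i), v} \<in> ?E}
      = (if Suc i < l then {V i, V (Suc (Suc i))} else {V i})" if "i < l" for i
    using that by (auto simp: V bident_edges_def doubleton_eq_iff)
  have all: "(\<forall>u\<in>?V. P u) \<longleftrightarrow> P VX \<and> P VY \<and> P (V 0) \<and> (\<forall>i<l. P (V (Suc i)))" for P
    unfolding Ball_def bident_verts_cases by blast
  have "(\<forall>u\<in>?V. (\<Sum>v\<in>?V. (diag_matrix d u v - adjacency ?E u v) * r v) = 0) \<longleftrightarrow>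
    (\<forall>u\<in>?V. d u * r u = (\<Sum>v\<in>{v\<in>?V. {u, v} \<in> ?E}. r v))"
    by (intro ball_cong refl) (simp only: nbr right_minus_eq)
  also have "\<dots> \<longleftrightarrow>
    d VX * r VX = r (V 0) \<and> d VY * r VY = r (V 0) \<and>
    d (V 0) * r (V 0) = r VX + r VY + tail_of l r 1 \<and>
    (\<forall>i<l. d (V (Suc i)) * tail_of l r (Suc i) = tail_of l r i + tail_of l r (Suc (Suc i)))"
  proof -
    have "(\<forall>i<l. d (V (Suc i)) * r (V (Suc i)) = (\<Sum>v\<in>{v\<in>?V. {V (Suc i), v} \<in> ?E}. r v)) \<longleftrightarrow>
      (\<forall>i<l. d (V (Suc i)) * tail_of l r (Suc i) = tail_of l r i + tail_of l r (Suc (Suc i)))"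
      by (intro all_cong) (simp add: nbrS tail_of_def)
    then show ?thesis unfolding all nbrs by (auto simp: tail_of_def)
  qed
  finally show ?thesis
    unfolding Arith_bident_def Arith_def by blast
qed

lemma finite_bident_verts: "finite (bident_verts n)"
  by (simp add: bident_verts_def)

text \<open>Going back from \<open>V l\<close>, the equations express all tail labels through
  \<open>r (V l)\<close>, and \<open>r (V 0)\<close> then fixes \<open>r VX\<close> and
  \<open>r VY\<close>; the gcd condition removes the remaining scale factor.\<close>

lemma inj_on_fst_Arith_bident: "inj_on fst (Arith_bident (l + 3))"
proof (rule inj_onI, clarsimp)
  fix d r r' assume 1: "(d, r) \<in> Arith_bident (l + 3)" and 2: "(d, r') \<in> Arith_bident (l + 3)"
  let ?V = "bident_verts (l + 3)"
  let ?s = "tail_of l r" and ?s' = "tail_of l r'"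
  note e = 1[unfolded Arith_bident_iff] and e' = 2[unfolded Arith_bident_iff]
  have pos: "0 < d v" "0 < r v" "0 < r' v" if "v \<in> ?V" for v
    using e e' that by (auto simp: PiE_iff)
  have inV: "VX \<in> ?V" "VY \<in> ?V" "i \<le> l \<Longrightarrow> V i \<in> ?V" for i
    by (auto simp: bident_verts_def)
  \<comment> \<open>Proportionality in cross-multiplied form, for consecutive pairs because the
    recurrence has order two.\<close>
  have t: "?s i * ?s' l = ?s' i * ?s l \<and> ?s (Suc i) * ?s' l = ?s' (Suc i) * ?s l" if "i \<le> l" for i
    using that
  proof (induction i rule: inc_induct)
    case base
    show ?case by (simp add: tail_of_def)
  next
    case (step i)
    let ?c = "d (V (Suc i))"
    have a: "?s i = ?c * ?s (Suc i) - ?s (Suc (Suc i))"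
      and a': "?s' i = ?c * ?s' (Suc i) - ?s' (Suc (Suc i))"
      using e e' step by auto
    show ?case
    proof
      have "?s i * ?s' l = ?c * (?s (Suc i) * ?s' l) - ?s (Suc (Suc i)) * ?s' l"
        by (simp add: a algebra_simps)
      also have "\<dots> = ?c * (?s' (Suc i) * ?s l) - ?s' (Suc (Suc i)) * ?s l"
        using step by simp
      also have "\<dots> = ?s' i * ?s l" by (simp add: a' algebra_simps)
      finally show "?s i * ?s' l = ?s' i * ?s l" .
    qed (use step in simp)
  qed
  have tV: "r (V i) * r' (V l) = r' (V i) * r (V l)" if "i \<le> l" for i
    using t[OF that] that by (simp add: tail_of_def)
  have "r u * r' (V l) = r' u * r (V l)" if u: "u = VX \<or> u = VY" for u
  proof -
    have "d u * r u = r (V 0)" "d u * r' u = r' (V 0)" using e e' u by auto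
    then have "d u * (r u * r' (V l)) = d u * (r' u * r (V l))"
      using tV[of 0] by (simp add: mult.assoc[symmetric])
    then show ?thesis using pos(1)[of u] inV u by auto
  qed
  with tV have all: "r' (V l) * r v = r (V l) * r' v" if "v \<in> ?V" for v
    using that by (auto simp: bident_verts_def mult.commute)
  have "(*) (r' (V l)) ` r ` ?V = (*) (r (V l)) ` r' ` ?V"
    using all by (auto simp: image_image intro!: image_cong)
  then have "Gcd ((*) (r' (V l)) ` r ` ?V) = Gcd ((*) (r (V l)) ` r' ` ?V)" by simp
  then have "r' (V l) = r (V l)"
    using e e' pos[OF inV(3)[of l]] by (simp add: Gcd_mult)
  then have "r v = r' v" if "v \<in> ?V" for v
    using all[OF that] pos[OF inV(3)[of l]] by auto
  then show "r = r'" using e e' by (intro PiE_ext[of r ?V _ r']) auto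
qed

lemma finite_Arith_bident: "finite (Arith_bident (l + 3))"
proof (rule finite_imageD[OF _ inj_on_fst_Arith_bident])
  show "finite (fst ` Arith_bident (l + 3))"
    unfolding Arith_bident_def by (rule finite_Arith_diagonals[OF finite_bident_verts])
qed

section \<open>Encoding of the structures on the bident\<close>

text \<open>Every common divisor of \<open>r\<^sub>x, r\<^sub>y, r\<^sub>0\<close> divides the whole tail, so coprimality is a
  condition at the root.\<close>

definition bident_root :: "int \<times> int \<Rightarrow> int \<Rightarrow> int \<Rightarrow> bool" where
  "bident_root = (\<lambda>(x, y) a b. 0 < x \<and> 0 < y \<and> x dvd a \<and> y dvd a \<and> a dvd x + y + b \<and>
     gcd x (gcd y a) = 1)"

definition encode :: "nat \<Rightarrow> (bident_vertex \<Rightarrow> int) \<times> (bident_vertex \<Rightarrow> int) \<Rightarrow>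
    (int \<times> int) \<times> (nat \<Rightarrow> int)" where
  "encode l = (\<lambda>(d, r). ((r VX, r VY), tail_of l r))"

lemma dvd_tail:
  assumes r: "r \<in> tails l" and g: "g dvd r 0" "g dvd r 1"
  shows "g dvd r i"
proof -
  have "g dvd r i \<and> g dvd r (Suc i)"
  proof (induction i)
    case 0
    then show ?case using g by simp
  next
    case (Suc i)
    show ?case
    proof (cases "i < l")
      case True
      then have "r (Suc i) dvd r i + r (Suc (Suc i))" using r by (auto simp: tails_def)
      then have "g dvd r i + r (Suc (Suc i))" using Suc dvd_trans by blast
      then show ?thesis using Suc by (simp add: dvd_add_right_iff)
    next
      case False
      then show ?thesis using Suc r by (auto simp: tails_def)
    qed
  qed
  then show ?thesis ..
qed

lemma Gcd_bident:
  assumes t: "tail_of l r \<in> tails l" and dv: "r (V 0) dvd r VX + r VY + tail_of l r 1"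
  shows "Gcd (r ` bident_verts (l + 3)) = gcd (r VX) (gcd (r VY) (r (V 0)))" (is "?G = ?g")
proof (rule zdvd_antisym_nonneg)
  show "?G dvd ?g" 
    by (intro gcd_greatest Gcd_dvd imageI) (auto simp: bident_verts_def)
  have g: "?g dvd r VX" "?g dvd r VY" "?g dvd r (V 0)"
    by (auto intro: dvd_trans[OF gcd_dvd2])
  have "?g dvd r VX + r VY + tail_of l r 1" using g(3) dv by (rule dvd_trans)
  then have "?g dvd tail_of l r 1" using g by (simp add: dvd_add_right_iff)
  moreover have "?g dvd tail_of l r 0" using g by (simp add: tail_of_def)
  ultimately have "?g dvd tail_of l r i" for i using dvd_tail[OF t] by blast
  then have "?g dvd r (V i)" if "i \<le> l" for i using that by (metis tail_of_def)
  then show "?g dvd ?G" using g by (intro Gcd_greatest) (auto simp: bident_verts_def)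
qed auto

text \<open>Forgetting \<open>d\<close> loses nothing: its entries are the quotients of neighbour
  sums by labels, and the divisibilities in \<open>rooted\<close> say that these are
  integers.\<close>

lemma bij_betw_encode: "bij_betw (encode l) (Arith_bident (l + 3)) (rooted bident_root l l)"
proof -
  let ?V = "bident_verts (l + 3)"
  have V: "?V = insert VX (insert VY (V ` {0..l}))" by (auto simp: bident_verts_def)
  have into: "encode l (d, r) \<in> rooted bident_root l l" if A: "(d, r) \<in> Arith_bident (l + 3)" for d r
  proof -
    note e = A[unfolded Arith_bident_iff]
    have "0 < tail_of l r i" if "i \<le> l" for i
      using e that by (auto simp: tail_of_def V PiE_iff)
    moreover have "tail_of l r (Suc i) dvd tail_of l r i + tail_of l r (Suc (Suc i))" if "i < l" for i
      using e that by (metis dvd_triv_right)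
    ultimately have t: "tail_of l r \<in> tails l" by (auto simp: tails_def tail_of_def)
    have dv: "r (V 0) dvd r VX + r VY + tail_of l r 1"
      using e by (metis dvd_triv_right)
    have "r VX dvd r (V 0)" "r VY dvd r (V 0)" using e by (metis dvd_triv_right)+
    moreover have "0 < r VX" "0 < r VY" using e by (auto simp: V PiE_iff)
    ultimately have "bident_root (r VX, r VY) (tail_of l r 0) (tail_of l r 1)"
      using dv Gcd_bident[OF t dv] e by (simp add: bident_root_def tail_of_def)
    then show ?thesis using t by (auto simp: encode_def rooted_def)
  qed
  have inj: "inj_on (encode l) (Arith_bident (l + 3))"
  proof (rule inj_onI, clarify)
    fix d r d' r' assume 1: "(d, r) \<in> Arith_bident (l + 3)" and 2: "(d', r') \<in> Arith_bident (l + 3)"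
      and eq: "encode l (d, r) = encode l (d', r')"
    note e = 1[unfolded Arith_bident_iff] and e' = 2[unfolded Arith_bident_iff]
    have t: "tail_of l r = tail_of l r'" and xy: "r VX = r' VX" "r VY = r' VY"
      using eq by (auto simp: encode_def)
    have rV: "r (V i) = r' (V i)" if "i \<le> l" for i
      using fun_cong[OF t, of i] that by (simp add: tail_of_def)
    have "r = r'"
      using e e' rV xy by (intro PiE_ext[of r ?V _ r']) (auto simp: V)
    have pos: "0 < r v" if "v \<in> ?V" for v using e that by (auto simp: PiE_iff)
    have "d v * r v = d' v * r v" if v: "v \<in> ?V" for v
    proof -
      consider "v = VX" | "v = VY" | "v = V 0" | i where "v = V (Suc i)" "i < l"
        using v unfolding bident_verts_cases by blast
      then show ?thesis
        using e e' \<open>r = r'\<close>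
        by cases (auto simp: tail_of_def)
    qed
    then have "d v = d' v" if "v \<in> ?V" for v using pos[OF that] that by fastforce
    then have "d = d'" using e e' by (intro PiE_ext[of d ?V _ d']) auto
    with \<open>r = r'\<close> show "d = d' \<and> r = r'" by simp
  qed
  have onto: "\<exists>dr\<in>Arith_bident (l + 3). encode l dr = ((x, y), s)"
    if A: "((x, y), s) \<in> rooted bident_root l l" for x y s
  proof -
    have s: "s \<in> tails l" and root: "bident_root (x, y) (s 0) (s 1)"
      using A by (auto simp: rooted_def)
    have x: "0 < x" "0 < y" "x dvd s 0" "y dvd s 0" "s 0 dvd x + y + s 1" "gcd x (gcd y (s 0)) = 1"
      using root by (auto simp: bident_root_def)
    have spos: "0 < s i" if "i \<le> l" for i using s that by (auto simp: tails_def)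
    have snn: "0 \<le> s i" for i
      using s by (cases "i \<le> l") (auto simp: tails_def less_imp_le)
    define r where "r = restrict (case_bident_vertex x y s) ?V"
    define d where "d = restrict (case_bident_vertex (s 0 div x) (s 0 div y)
       (case_nat ((x + y + s 1) div s 0) (\<lambda>i. (s i + s (Suc (Suc i))) div s (Suc i)))) ?V"
    have r: "r VX = x" "r VY = y" "i \<le> l \<Longrightarrow> r (V i) = s i" for i
      by (auto simp: r_def V)
    have tr: "tail_of l r = s" using s r by (auto simp: tail_of_def fun_eq_iff tails_def)
    have dS: "s (Suc i) dvd s i + s (Suc (Suc i))" if "i < l" for i
      using s that by (auto simp: tails_def)
    have d: "d VX * x = s 0" "d VY * y = s 0" "d (V 0) * s 0 = x + y + s 1"
      "i < l \<Longrightarrow> d (V (Suc i)) * s (Suc i) = s i + s (Suc (Suc i))" for i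
      using x dS[of i] by (auto simp: d_def V)
    have rP: "r \<in> ?V \<rightarrow>\<^sub>E {0<..}"
      using x spos by (auto simp: V PiE_iff r) (auto simp: r_def V)
    have "0 < d v" if v: "v \<in> ?V" for v
    proof -
      have *: "0 < a" if "a * b = c" "0 < b" "0 < c" for a b c :: int
        using that by (metis zero_less_mult_pos2)
      consider "v = VX" | "v = VY" | "v = V 0" | i where "v = V (Suc i)" "i < l"
        using v unfolding bident_verts_cases by blast
      then show ?thesis
      proof cases
        case 1 then show ?thesis using *[OF d(1)] x spos[of 0] by simp
      next
        case 2 then show ?thesis using *[OF d(2)] x spos[of 0] by simp
      next
        case 3 then show ?thesis using *[OF d(3)] x spos[of 0] snn[of 1] by simp
      next
        case 4 then show ?thesis
          using *[OF d(4)[of i]] spos[of i] spos[of "Suc i"] snn[of "Suc (Suc i)"] by simp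
      qed
    qed
    then have dP: "d \<in> ?V \<rightarrow>\<^sub>E {0<..}" by (auto simp: PiE_iff d_def)
    have "Gcd (r ` ?V) = 1"
      using Gcd_bident[of l r] x s by (simp add: tr r)
    then have "(d, r) \<in> Arith_bident (l + 3)"
      unfolding Arith_bident_iff tr using rP dP d by (simp add: r)
    moreover have "encode l (d, r) = ((x, y), s)" by (simp add: encode_def tr r)
    ultimately show ?thesis by blast
  qed
  have "encode l ` Arith_bident (l + 3) = rooted bident_root l l"
  proof (intro equalityI subsetI)
    fix z assume "z \<in> rooted bident_root l l"
    then show "z \<in> encode l ` Arith_bident (l + 3)"
      using onto[of "fst (fst z)" "snd (fst z)" "snd z"] by force
  qed (use into in auto)
  with inj show ?thesis by (simp add: bij_betw_def)
qed

section \<open>Counting\<close>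

text \<open>The structures with \<open>d\<^sub>x, d\<^sub>y \<ge> 2\<close>.\<close>

definition proper_root :: "int \<times> int \<Rightarrow> int \<Rightarrow> int \<Rightarrow> bool" where
  "proper_root h a b \<longleftrightarrow> bident_root h a b \<and> fst h \<noteq> a \<and> snd h \<noteq> a"

lemma finite_rooted_bident_root: "finite (rooted bident_root l p)"
proof (rule finite_subset)
  show "rooted bident_root l p \<subseteq> rooted bident_root l l" by (auto simp: rooted_def)
  show "finite (rooted bident_root l l)"
    using bij_betw_finite[OF bij_betw_encode] finite_Arith_bident by blast
qed

lemma finite_rooted_proper_root: "finite (rooted proper_root l p)"
  by (rule finite_subset[OF _ finite_rooted_bident_root[of l p]])
    (auto simp: rooted_def proper_root_def)

text \<open>Label 1 at both \<open>VX\<close> and \<open>VY\<close> turns a tail with root label 1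
  into a structure on the bident.\<close>

lemma finite_rooted_path_root: "finite (rooted path_root l p)"
proof (rule inj_on_finite)
  show "inj_on (\<lambda>(h, r). ((1, 1), r)) (rooted path_root l p)" by (auto simp: inj_on_def)
  show "(\<lambda>(h, r). ((1, 1), r)) ` rooted path_root l p \<subseteq> rooted bident_root l p"
    by (auto simp: rooted_def path_root_def bident_root_def)
qed (rule finite_rooted_bident_root)

text \<open>An entry of \<open>d\<close> is 1 exactly when the label equals its neighbour sum.
  \<open>proper_root\<close> excludes this at \<open>VX\<close> and \<open>VY\<close>, the bound 0
  at \<open>V 1\<close>, ..., \<open>V l\<close>.\<close>

lemma card_SArith_bident: "card (SArith_bident (l + 3)) = card (rooted proper_root l 0)"
proof -
  have iff': "(d, r) \<in> SArith_bident (l + 3) \<longleftrightarrow> encode l (d, r) \<in> rooted proper_root l 0"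
    if A: "(d, r) \<in> Arith_bident (l + 3)" for d r
  proof -
    note e = A[unfolded Arith_bident_iff]
    have two: "2 \<le> a \<longleftrightarrow> b \<noteq> c" if "a * b = c" "0 < a" "0 < b" for a b c :: int
    proof -
      have "b = c \<longleftrightarrow> a = 1" using that by auto
      then show ?thesis using that by linarith
    qed
    have pos: "0 < d v" "0 < r v" if "v \<in> bident_verts (l + 3)" for v
      using e that by (auto simp: PiE_iff)
    have inV: "VX \<in> bident_verts (l + 3)" "VY \<in> bident_verts (l + 3)"
      "i \<le> l \<Longrightarrow> V i \<in> bident_verts (l + 3)" for i
      by (auto simp: bident_verts_def)
    have x: "2 \<le> d VX \<longleftrightarrow> r VX \<noteq> r (V 0)"
      by (rule two) (use e pos[OF inV(1)] in blast)+
    have y: "2 \<le> d VY \<longleftrightarrow> r VY \<noteq> r (V 0)"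
      by (rule two) (use e pos[OF inV(2)] in blast)+
    have t: "2 \<le> d (V (Suc i)) \<longleftrightarrow>
        tail_of l r (Suc i) \<noteq> tail_of l r i + tail_of l r (Suc (Suc i))" if "i < l" for i
      by (rule two) (use e pos[OF inV(3)[of "Suc i"]] that in \<open>simp_all add: tail_of_def\<close>)
    have "{1..l} = Suc ` {..<l}" by (simp add: lessThan_atLeast0 atLeastLessThanSuc_atLeastAtMost)
    then have idx: "(\<forall>i\<in>{1..l}. 2 \<le> d (V i)) \<longleftrightarrow> (\<forall>i<l. 2 \<le> d (V (Suc i)))"
      by auto
    have S: "(d, r) \<in> SArith_bident (l + 3) \<longleftrightarrow>
        r VX \<noteq> r (V 0) \<and> r VY \<noteq> r (V 0) \<and>
        (\<forall>i<l. tail_of l r (Suc i) \<noteq> tail_of l r i + tail_of l r (Suc (Suc i)))"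
      using A by (simp add: SArith_bident_def x y t idx del: One_nat_def)
    have "encode l (d, r) \<in> rooted bident_root l l"
      using bij_betw_encode A by (auto simp: bij_betw_def)
    then have "tail_of l r \<in> tails l"
      "bident_root (r VX, r VY) (tail_of l r 0) (tail_of l r 1)"
      by (simp_all add: encode_def rooted_def)
    then show ?thesis
      unfolding S by (simp add: encode_def rooted_def proper_root_def) (simp add: tail_of_def)
  qed
  have iff: "z \<in> SArith_bident (l + 3) \<longleftrightarrow> encode l z \<in> rooted proper_root l 0"
    if "z \<in> Arith_bident (l + 3)" for z
    using iff'[of "fst z" "snd z"] that by simp
  have "bij_betw (encode l) (SArith_bident (l + 3)) (rooted proper_root l 0)"
  proof (rule bij_betw_subset[OF bij_betw_encode])
    show sub: "SArith_bident (l + 3) \<subseteq> Arith_bident (l + 3)" by (auto simp: SArith_bident_def)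
    have "rooted proper_root l 0 \<subseteq> encode l ` Arith_bident (l + 3)"
      using bij_betw_encode by (auto simp: bij_betw_def rooted_def proper_root_def)
    then have "rooted proper_root l 0 = encode l ` {z \<in> Arith_bident (l + 3). encode l z \<in> rooted proper_root l 0}"
      by blast
    also have "{z \<in> Arith_bident (l + 3). encode l z \<in> rooted proper_root l 0} = SArith_bident (l + 3)"
      using iff sub by blast
    finally show "encode l ` SArith_bident (l + 3) = rooted proper_root l 0" ..
  qed
  then show ?thesis by (rule bij_betw_same_card)
qed

text \<open>If \<open>d\<^sub>x = 1\<close>, deleting \<open>v\<^sub>x\<close> leaves a structure on the path
  \<open>v\<^sub>y v\<^sub>0 \<dots> v\<^sub>l\<close>, whose end labels are 1.\<close>

lemma card_bident_root_left:
  "card {(h, r) \<in> rooted bident_root l l. fst h = r 0} = card (rooted path_root (Suc l) (Suc l))"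
proof -
  have "bij_betw (\<lambda>(h, s). ((s 1, 1), \<lambda>i. s (Suc i))) (rooted path_root (Suc l) (Suc l))
      {(h, r) \<in> rooted bident_root l l. fst h = r 0}"
  proof (rule bij_betw_byWitness[where f' = "\<lambda>(h, r). ((), case_nat 1 r)"])
    show "\<forall>a\<in>rooted path_root (Suc l) (Suc l).
      (\<lambda>(h, r). ((), case_nat 1 r)) ((\<lambda>(h, s). ((s 1, 1), \<lambda>i. s (Suc i))) a) = a"
      by (auto simp: rooted_def path_root_def fun_eq_iff split: nat.split)
    \<comment> \<open>Since \<open>y\<close> divides \<open>a\<close>, the number
      \<open>gcd a (gcd y a)\<close> is \<open>y\<close> itself.\<close>
    have y1: "y = 1" if "bident_root (a, y) a b" for a b y
      using that by (auto simp: bident_root_def gcd.left_commute gcd_proj1_if_dvd)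
    then show "\<forall>a\<in>{(h, r) \<in> rooted bident_root l l. fst h = r 0}.
      (\<lambda>(h, s). ((s 1, 1), \<lambda>i. s (Suc i))) ((\<lambda>(h, r). ((), case_nat 1 r)) a) = a"
      by (auto simp: rooted_def)
    show "(\<lambda>(h, s). ((s 1, 1), \<lambda>i. s (Suc i))) ` rooted path_root (Suc l) (Suc l)
      \<subseteq> {(h, r) \<in> rooted bident_root l l. fst h = r 0}"
    proof clarsimp
      fix s assume s: "((), s) \<in> rooted path_root (Suc l) (Suc l)"
      have t: "s \<in> tails (Suc l)" and s0: "s 0 = 1"
        using s by (auto simp: rooted_def path_root_def)
      have "s (Suc 0) dvd s 0 + s (Suc (Suc 0))" using t unfolding tails_def by blast
      moreover have "0 < s (Suc 0)" using t by (auto simp: tails_def)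
      ultimately have "bident_root (s (Suc 0), 1) (s (Suc 0)) (s (Suc (Suc 0)))"
        using s0 by (simp add: bident_root_def add.assoc)
      moreover have "(\<lambda>i. s (Suc i)) \<in> tails l" using t by (auto simp: tails_def)
      ultimately show "((s (Suc 0), 1), \<lambda>i. s (Suc i)) \<in> rooted bident_root l l"
        by (auto simp: rooted_def)
    qed
    show "(\<lambda>(h, r). ((), case_nat 1 r)) ` {(h, r) \<in> rooted bident_root l l. fst h = r 0}
      \<subseteq> rooted path_root (Suc l) (Suc l)"
    proof clarsimp
      fix y r assume r: "((r 0, y), r) \<in> rooted bident_root l l"
      then have t: "r \<in> tails l" and root: "bident_root (r 0, y) (r 0) (r 1)"
        by (auto simp: rooted_def)
      \<comment> \<open>Cancelling the summand \<open>r 0\<close> at \<open>VX\<close> turns the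
        root condition into the one at position 1 of the longer tail.\<close>
      have dv: "r 0 dvd 1 + r 1" using root y1[OF root] by (simp add: bident_root_def add.assoc)
      have "case_nat 1 r \<in> tails (Suc l)"
        unfolding tails_def
      proof (clarsimp, intro conjI allI impI)
        fix i
        show "0 < (case i of 0 \<Rightarrow> 1 | Suc x \<Rightarrow> r x)" if "i \<le> Suc l"
          using that t by (auto simp: tails_def split: nat.split)
        show "(case i of 0 \<Rightarrow> 1 | Suc x \<Rightarrow> r x) = 0" if "Suc l < i"
          using that t by (auto simp: tails_def split: nat.split)
        show "r i dvd (case i of 0 \<Rightarrow> 1 | Suc x \<Rightarrow> r x) + r (Suc i)" if "i < Suc l"
          using that t dv by (auto simp: tails_def split: nat.split)
      qed
      then show "((), case_nat 1 r) \<in> rooted path_root (Suc l) (Suc l)"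
        by (auto simp: rooted_def path_root_def)
    qed
  qed
  then show ?thesis by (rule bij_betw_same_card[symmetric])
qed

lemma card_bident_root_right:
  "card {(h, r) \<in> rooted bident_root l l. snd h = r 0} = card (rooted path_root (Suc l) (Suc l))"
proof -
  have sym: "bident_root (x, y) a b = bident_root (y, x) a b" for x y a b
    by (auto simp: bident_root_def add.commute gcd.left_commute)
  have "bij_betw (map_prod prod.swap id) {(h, r) \<in> rooted bident_root l l. snd h = r 0}
      {(h, r) \<in> rooted bident_root l l. fst h = r 0}"
    by (rule bij_betw_byWitness[where f' = "map_prod prod.swap id"])
      (auto simp: rooted_def sym)
  from bij_betw_same_card[OF this] show ?thesis by (simp only: card_bident_root_left)
qed

text \<open>Coprimality of three equal labels forces them to be 1, which makes the divisibility at
  the root automatic.\<close>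

lemma card_bident_root_both:
  "card {(h, r) \<in> rooted bident_root l l. fst h = r 0 \<and> snd h = r 0} = card (rooted path_root l l)"
proof -
  have one: "a = 1" if "bident_root (a, a) a b" for a b
    using that by (auto simp: bident_root_def)
  have "bij_betw (\<lambda>(h, r). ((1, 1), r)) (rooted path_root l l)
      {(h, r) \<in> rooted bident_root l l. fst h = r 0 \<and> snd h = r 0}"
    by (rule bij_betw_byWitness[where f' = "\<lambda>(h, r). ((), r)"])
      (auto simp: rooted_def path_root_def bident_root_def dest: one)
  then show ?thesis by (rule bij_betw_same_card[symmetric])
qed

text \<open>Proper divisors \<open>x\<close>, \<open>y\<close> of \<open>r 0\<close> are at most
  half of it, while \<open>r 0 dvd x + y\<close> gives \<open>r 0 \<le> x + y\<close>. So both are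
  exactly half, and coprimality makes them 1.\<close>

lemma card_rooted_proper_root_0: "card (rooted proper_root 0 0) = 1"
proof -
  have "rooted proper_root 0 0 = {((1, 1), \<lambda>i. if i = 0 then 2 else 0)}" (is "_ = {?z}")
  proof (intro equalityI subsetI)
    fix z assume "z \<in> rooted proper_root 0 0"
    then obtain x y r where z: "z = ((x, y), r)" and t: "r \<in> tails 0"
      and root: "proper_root (x, y) (r 0) (r 1)"
      by (auto simp: rooted_def)
    have r1: "r i = 0" if "0 < i" for i using t that by (auto simp: tails_def)
    have r0: "0 < r 0" using t by (auto simp: tails_def)
    have x: "0 < x" "0 < y" "x dvd r 0" "y dvd r 0" "r 0 dvd x + y" "gcd x (gcd y (r 0)) = 1"
      "x \<noteq> r 0" "y \<noteq> r 0"
      using root r1[of 1] by (auto simp: proper_root_def bident_root_def)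
    have half: "2 * u \<le> r 0" if u: "u dvd r 0" "0 < u" "u \<noteq> r 0" for u
    proof -
      obtain k where k: "r 0 = u * k" using u(1) ..
      have "0 < k" using k r0 u by (simp add: zero_less_mult_iff)
      moreover have "k \<noteq> 1" using k u by auto
      ultimately have "u * 2 \<le> u * k" using u by (intro mult_left_mono) auto
      then show ?thesis using k by simp
    qed
    have "r 0 \<le> x + y" using x by (intro zdvd_imp_le) auto
    then have eq: "r 0 = 2 * x" "y = x" using half[of x] half[of y] x by auto
    then have "x = 1" using x by simp
    then have "r = (\<lambda>i. if i = 0 then 2 else 0)" using r1 eq by (auto simp: fun_eq_iff)
    then show "z \<in> {?z}" using z eq \<open>x = 1\<close> by simp
  qed (auto simp: rooted_def proper_root_def bident_root_def tails_def)
  then show ?thesis by simp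
qed

text \<open>Inclusion-exclusion over \<open>d VX = 1\<close> and \<open>d VY = 1\<close>: each holds
  for \<open>catalan (Suc l)\<close> structures, both for \<open>catalan l\<close>.\<close>

lemma card_rooted_bident_root:
  "real (card (rooted bident_root l l)) =
    2 * catalan (Suc l) - catalan l + real (card (rooted proper_root l l))"
proof -
  let ?X = "{(h, r) \<in> rooted bident_root l l. fst h = r 0}"
  let ?Y = "{(h, r) \<in> rooted bident_root l l. snd h = r 0}"
  have fin: "finite ?X" "finite ?Y"
    by (auto intro: finite_subset[OF _ finite_rooted_bident_root[of l l]])
  have "rooted bident_root l l = (?X \<union> ?Y) \<union> rooted proper_root l l"
    by (auto simp: rooted_def proper_root_def)
  moreover have "(?X \<union> ?Y) \<inter> rooted proper_root l l = {}"
    by (auto simp: rooted_def proper_root_def)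
  ultimately have "card (rooted bident_root l l) = card (?X \<union> ?Y) + card (rooted proper_root l l)"
    using fin finite_rooted_proper_root by (metis (no_types, lifting) card_Un_disjoint finite_UnI)
  moreover have "card ?X + card ?Y = card (?X \<union> ?Y) + card (?X \<inter> ?Y)"
    using fin by (rule card_Un_Int)
  moreover have "?X \<inter> ?Y = {(h, r) \<in> rooted bident_root l l. fst h = r 0 \<and> snd h = r 0}" by auto
  ultimately show ?thesis
    using card_path_root[OF finite_rooted_path_root, of l]
      card_path_root[OF finite_rooted_path_root, of "Suc l"]
    by (simp add: card_bident_root_left card_bident_root_right card_bident_root_both)
qed

theorem theorem2p12:
  fixes n :: nat
  assumes "n \<ge> 3"
  shows "real (card (Arith_bident n)) =
    2 * catalan (n - 2) + (\<Sum>m = 4..n. ballot (n - 3) (n - m) * real (card (SArith_bident m)))"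
proof -
  obtain l where n: "n = l + 3" using assms by (metis add.commute le_Suc_ex)
  have "real (card (rooted proper_root l l))
      = (\<Sum>s\<le>l. ballot l (l - s) * real (card (rooted proper_root s 0)))"
  proof (rule card_rooted)
    \<comment> \<open>Adding \<open>a\<close> does not affect whether \<open>a\<close> divides
      \<open>x + y + b\<close>.\<close>
    show "proper_root h a (a + b) = proper_root h a b" for h a b
      by (cases h) (auto simp: proper_root_def bident_root_def add.left_commute[of _ a])
  qed (rule finite_rooted_proper_root)
  also have "\<dots> = (\<Sum>s\<le>l. ballot l (l - s) * real (card (SArith_bident (s + 3))))"
    by (simp only: card_SArith_bident)
  also have "\<dots> = (\<Sum>m = 0+3..l+3. ballot l (n - m) * real (card (SArith_bident m)))"
    unfolding sum.shift_bounds_cl_nat_ivl by (simp add: n atMost_atLeast0)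
  \<comment> \<open>The term for \<open>m = 3\<close> is \<open>ballot l l = catalan l\<close>,
    which cancels the overlap subtracted in \<open>card_rooted_bident_root\<close>.\<close>
  also have "\<dots> = ballot l l * real (card (SArith_bident 3))
      + (\<Sum>m = 4..n. ballot l (n - m) * real (card (SArith_bident m)))"
    by (simp add: n sum.atLeast_Suc_atMost[of 3 "l + 3"])
  also have "real (card (SArith_bident 3)) = 1"
    using card_SArith_bident[of 0] card_rooted_proper_root_0 by simp
  also have "ballot l l * 1 = catalan l" by (simp add: ballot_def catalan_def mult_2)
  finally show ?thesis
    using card_rooted_bident_root[of l] bij_betw_same_card[OF bij_betw_encode[of l]] by (simp add: n)
qed

end
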